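(* For all $\alpha,\lambda\in\mathbb C$ and $w\in\mathbb C\setminus]-\infty,-1]$, the normalized Gegenbauer function $\mathbf S_{\alpha,\lambda}$ satisfies the following eight recurrence relations: $$\partial_w\mathbf S_{\alpha,\lambda}(w)=-\tfrac12\big(\tfrac12+\alpha-\lambda\big)\big(\tfrac12+\alpha+\lambda\big)\mathbf S_{\alpha+1,\lambda}(w),$$ $$\big((1-w^2)\partial_w-2\alpha w\big)\mathbf S_{\alpha,\lambda}(w)=-2\,\mathbf S_{\alpha-1,\lambda}(w),$$ $$\Big((1-w^2)\partial_w-\big(\tfrac12+\alpha+\lambda\big)w\Big)\mathbf S_{\alpha,\lambda}(w)=-\big(\tfrac12+\alpha+\lambda\big)\mathbf S_{\alpha,\lambda+1}(w),$$ $$\Big((1-w^2)\partial_w-\big(\tfrac12+\alpha-\lambda\big)w\Big)\mathbf S_{\alpha,\lambda}(w)=-\big(\tfrac12+\alpha-\lambda\big)\mathbf S_{\alpha,\lambda-1}(w);$$ $$\Big(w\partial_w+\tfrac12+\alpha-\lambda\Big)\mathbf S_{\alpha,\lambda}(w)=\tfrac12\big(\tfrac12+\alpha-\lambda\big)\big(\tfrac32+\alpha-\lambda\big)\mathbf S_{\alpha+1,\lambda-1}(w),$$ $$\Big(w(1-w^2)\partial_w+\big(\tfrac12-\alpha+\lambda\big)(1-w^2)-2\alpha w^2\Big)\mathbf S_{\alpha,\lambda}(w)=-2\,\mathbf S_{\alpha-1,\lambda+1}(w),$$ $$\Big(w\partial_w+\tfrac12+\alpha+\lambda\Big)\mathbf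 S_{\alpha,\lambda}(w)=\tfrac12\big(\tfrac12+\alpha+\lambda\big)\big(\tfrac32+\alpha+\lambda\big)\mathbf S_{\alpha+1,\lambda+1}(w),$$ $$\Big(w(1-w^2)\partial_w+\big(\tfrac12-\alpha-\lambda\big)(1-w^2)-2\alpha w^2\Big)\mathbf S_{\alpha,\lambda}(w)=-2\,\mathbf S_{\alpha-1,\lambda-1}(w).$$
   Context: $\mathbf F(a,b;c;z)=\sum_{j\ge0}\frac{(a)_j(b)_j}{\Gamma(c+j)}\frac{z^j}{j!}$ (for $|z|<1$, with $1/\Gamma$ equal to $0$ at the poles of $\Gamma$), analytically continued to $\mathbb C\setminus[1,\infty[$, is the normalized Gauss hypergeometric function, defined for all $a,b,c\in\mathbb C$. The normalized Gegenbauer function is $$\mathbf S_{\alpha,\lambda}(w):=\mathbf F\Big(\tfrac12+\alpha-\lambda,\ \tfrac12+\alpha+\lambda;\ \alpha+1;\ \tfrac{1-w}{2}\Big).$$ *)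

theory Defs
  imports "HOL-Complex_Analysis.Complex_Analysis"
begin

definition hypergeo_series :: "complex \<Rightarrow> complex \<Rightarrow> complex \<Rightarrow> complex \<Rightarrow> complex" where
  "hypergeo_series a b c z =
     (\<Sum>j. pochhammer a j * pochhammer b j * rGamma (c + of_nat j) * z ^ j / fact j)"

definition hypergeo_domain :: "complex set" where
  "hypergeo_domain = - (complex_of_real ` {1..})"

(* The domain is connected and contains the unit disc, so by the identity theorem the choice
   below is determined on hypergeo_domain; values on the cut are unspecified. *)
definition hypergeo :: "complex \<Rightarrow> complex \<Rightarrow> complex \<Rightarrow> complex \<Rightarrow> complex" where
  "hypergeo a b c =
     (SOME f. f holomorphic_on hypergeo_domain \<and>
              (\<forall>z. norm z < 1 \<longrightarrow> f z = hypergeo_series a b c z))"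

definition gegenbauer_S :: "complex \<Rightarrow> complex \<Rightarrow> complex \<Rightarrow> complex" where
  "gegenbauer_S \<alpha> l w = hypergeo (1/2 + \<alpha> - l) (1/2 + \<alpha> + l) (\<alpha> + 1) ((1 - w) / 2)"

end

theory Submission
  imports Defs
begin

text \<open>
  The main issue is the existence of the analytic continuation of the hypergeometric series, for all
  parameters. The map \<open>u \<mapsto> 4u/(1+u)\<^sup>2\<close> is a bijection from the unit disc to
  \<open>\<complex> - [1,\<infinity>)\<close> with inverse \<open>(1 - s)/(1 + s)\<close>, \<open>s = \<surd>(1 - z)\<close>. The pullback of the series under this map is a
  formal power series in \<open>u\<close> that solves a linear differential equation whose leading coefficient
  \<open>u(1+u)\<^sup>2(1-u)\<close> has no zero in the punctured disc. Its coefficients therefore satisfy a three-step recurrence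
  whose characteristic roots have modulus one, so the pullback converges in the whole disc, and composing
  it with the inverse map gives the continuation. By the identity theorem, each recurrence relation
  then reduces to a comparison of Taylor coefficients at \<open>w = 1\<close>.
\<close>

subsection \<open>Growth of solutions of recurrences\<close>

text \<open>A ratio test on a majorant \<open>S\<close>. It may be chosen anew for each
  \<open>\<delta>\<close>, because the norm adapted to a recurrence with a double characteristic
  root depends on \<open>\<delta>\<close>.\<close>

lemma fps_conv_radius_ge_1I:
  fixes F :: "complex fps"
  assumes "\<And>\<delta>::real. \<delta> > 0 \<Longrightarrow> \<exists>S C. (\<forall>n. norm (fps_nth F n) \<le> C * S n) \<and> (\<forall>n. 0 \<le> S n) \<and>
             eventually (\<lambda>n. S (Suc n) \<le> (1 + \<delta>) * S n) sequentially"
  shows "fps_conv_radius F \<ge> 1"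
  unfolding fps_conv_radius_def
proof (rule conv_radius_geI_ex')
  fix r :: real assume r: "0 < r" "ereal r < 1"
  then have r1: "r < 1" by (simp add: one_ereal_def)
  \<comment> \<open>With this choice \<open>(1 + \<delta>) * r = (1 + r) / 2\<close>.\<close>
  define \<delta> where "\<delta> = (1 / r - 1) / 2"
  have d: "\<delta> > 0" using r r1 by (simp add: \<delta>_def)
  have q: "(1 + \<delta>) * r < 1" using r r1 by (simp add: \<delta>_def field_simps)
  from assms[OF d] obtain S C where S: "\<And>n. norm (fps_nth F n) \<le> C * S n" "\<And>n. 0 \<le> S n"
    "eventually (\<lambda>n. S (Suc n) \<le> (1 + \<delta>) * S n) sequentially" by blast
  then obtain N where N: "\<And>n. n \<ge> N \<Longrightarrow> S (Suc n) \<le> (1 + \<delta>) * S n"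
    by (auto simp: eventually_sequentially)
  have "summable (\<lambda>n. S n * r ^ n)"
  proof (rule summable_ratio_test[OF q])
    fix n assume "n \<ge> N"
    from N[OF this] have "S (Suc n) * r ^ Suc n \<le> (1 + \<delta>) * S n * r ^ Suc n"
      using r by (intro mult_right_mono) auto
    then show "norm (S (Suc n) * r ^ Suc n) \<le> (1 + \<delta>) * r * norm (S n * r ^ n)"
      using S(2) r by (simp add: abs_mult algebra_simps)
  qed
  then have "summable (\<lambda>n. C * (S n * r ^ n))" by (rule summable_mult)
  then show "summable (\<lambda>n. fps_nth F n * complex_of_real r ^ n)"
  proof (rule summable_comparison_test'[where N = 0])
    fix n
    show "norm (fps_nth F n * complex_of_real r ^ n) \<le> C * (S n * r ^ n)"
      using mult_right_mono[OF S(1)[of n], of "r ^ n"] r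
      by (simp add: norm_mult norm_power mult.assoc)
  qed
qed

text \<open>The characteristic polynomial is \<open>(x + 1)\<^sup>2 (x - 1)\<close>; the weighted maximum below is a norm for
  which the companion matrix has norm at most \<open>1 + \<delta>\<close>.\<close>
lemma fps_conv_radius_ge_1_recurrence:
  fixes G :: "complex fps" and A B C :: "nat \<Rightarrow> complex"
  assumes lim: "A \<longlonglongrightarrow> -1" "B \<longlonglongrightarrow> 1" "C \<longlonglongrightarrow> 1"
  assumes rec: "eventually (\<lambda>n. fps_nth G (n + 3) =
      A n * fps_nth G (n + 2) + B n * fps_nth G (n + 1) + C n * fps_nth G n) sequentially"
  shows "fps_conv_radius G \<ge> 1"
proof (rule fps_conv_radius_ge_1I)
  fix \<delta> :: real assume d: "\<delta> > 0"
  define g where "g = fps_nth G"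
  define S where "S n = max (max (norm (g (n+2) + g (n+1))) (norm (g (n+1) + g n))) (\<delta> * norm (g n))" for n
  \<comment> \<open>The three bounds on \<open>g\<close> below add up to
    \<open>(3 + 3 / \<delta>) * S n\<close>. Any \<open>K\<close> at least this large ensures that
    coefficient errors below \<open>\<delta> / K\<close> contribute at most
    \<open>\<delta> * S n\<close>.\<close>
  define K where "K = 6 + 3 / \<delta>"
  have K: "K > 0" using d by (simp add: K_def add_pos_pos)
  have S0: "0 \<le> S n" for n unfolding S_def by (meson le_max_iff_disj norm_ge_zero)
  have S1: "norm (g (n+2) + g (n+1)) \<le> S n" "norm (g (n+1) + g n) \<le> S n" "\<delta> * norm (g n) \<le> S n" for n
    by (auto simp: S_def)
  have g0: "norm (g n) \<le> 1 / \<delta> * S n" for n using S1(3)[of n] d by (simp add: field_simps)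
  have g1: "norm (g (n+1)) \<le> S n + 1 / \<delta> * S n" for n
    using g0[of n] S1(2)[of n] norm_triangle_ineq4[of "g (n+1) + g n" "g n"] by simp
  have g2: "norm (g (n+2)) \<le> 2 * S n + 1 / \<delta> * S n" for n
    using g1[of n] S1(1)[of n] norm_triangle_ineq4[of "g (n+2) + g (n+1)" "g (n+1)"] by simp
  have dK: "\<delta> / K > 0" using d K by simp
  have "eventually (\<lambda>n. dist (A n) (-1) < \<delta> / K) sequentially"
       "eventually (\<lambda>n. dist (B n) 1 < \<delta> / K) sequentially"
       "eventually (\<lambda>n. dist (C n) 1 < \<delta> / K) sequentially"
    using lim dK by (auto dest: tendstoD)
  then have "eventually (\<lambda>n. S (Suc n) \<le> (1 + \<delta>) * S n) sequentially"
    using rec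
  proof eventually_elim
    case (elim n)
    \<comment> \<open>The limiting recurrence reads
      \<open>g (n+3) + g (n+2) = g (n+1) + g n\<close>; \<open>err\<close> collects the deviation of
      the coefficients from their limits.\<close>
    define err where "err = (A n + 1) * g (n+2) + (B n - 1) * g (n+1) + (C n - 1) * g n"
    have eq: "g (n+3) + g (n+2) = (g (n+1) + g n) + err"
      using elim(4) by (simp add: g_def err_def algebra_simps)
    have b: "norm (x * y) \<le> \<delta> / K * norm y" if "norm x < \<delta> / K" for x y :: complex
      using mult_right_mono[OF less_imp_le[OF that] norm_ge_zero[of y]] by (simp add: norm_mult)
    have "norm err \<le> \<delta> / K * norm (g (n+2)) + \<delta> / K * norm (g (n+1)) + \<delta> / K * norm (g n)"
      unfolding err_def using elim(1-3)
      by (intro norm_triangle_mono b) (auto simp: dist_norm)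
    also have "\<dots> = \<delta> / K * (norm (g (n+2)) + norm (g (n+1)) + norm (g n))"
      by (simp add: algebra_simps)
    also have "\<dots> \<le> \<delta> / K * (K * S n)"
    proof (intro mult_left_mono)
      have "norm (g (n+2)) + norm (g (n+1)) + norm (g n) \<le> (3 + 3 / \<delta>) * S n"
        using add_mono[OF add_mono[OF g2[of n] g1[of n]] g0[of n]] by (simp add: algebra_simps)
      also have "\<dots> \<le> K * S n" using S0 by (intro mult_right_mono) (auto simp: K_def)
      finally show "norm (g (n+2)) + norm (g (n+1)) + norm (g n) \<le> K * S n" .
    qed (use dK in auto)
    also have "\<dots> = \<delta> * S n" using K by simp
    finally have e: "norm err \<le> \<delta> * S n" .
    have "norm (g (n+3) + g (n+2)) \<le> (1 + \<delta>) * S n"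
      unfolding eq using norm_triangle_ineq[of "g (n+1) + g n" err] e S1(2)[of n]
      by (simp add: algebra_simps)
    moreover have "norm (g (n+2) + g (n+1)) \<le> (1 + \<delta>) * S n"
      using S1(1)[of n] d S0[of n] by (simp add: algebra_simps add_increasing2)
    \<comment> \<open>Here the weight pays off: \<open>norm (g (n+1))\<close> is at most
      \<open>S n + norm (g n)\<close>, and scaling by \<open>\<delta>\<close> reduces the first
      summand to the admissible growth \<open>\<delta> * S n\<close>.\<close>
    moreover have "\<delta> * norm (g (n+1)) \<le> (1 + \<delta>) * S n"
      using mult_left_mono[OF g1[of n], of \<delta>] d by (simp add: algebra_simps)
    ultimately show ?case by (simp add: S_def numeral_3_eq_3 numeral_2_eq_2)
  qed
  with S0 g0 show "\<exists>S C. (\<forall>n. norm (fps_nth G n) \<le> C * S n) \<and> (\<forall>n. 0 \<le> S n) \<and>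
             eventually (\<lambda>n. S (Suc n) \<le> (1 + \<delta>) * S n) sequentially"
    unfolding g_def by blast
qed

subsection \<open>The hypergeometric series and its pullback\<close>

definition hyper_fps :: "complex \<Rightarrow> complex \<Rightarrow> complex \<Rightarrow> complex fps" where
  "hyper_fps a b c = Abs_fps (\<lambda>j. pochhammer a j * pochhammer b j * rGamma (c + of_nat j) / fact j)"

text \<open>From the functional equation of \<open>rGamma\<close>; kept free of division, so that it
  also covers \<open>c + of_nat n = 0\<close>.\<close>

lemma hyper_fps_Suc:
  "of_nat (Suc n) * (c + of_nat n) * fps_nth (hyper_fps a b c) (Suc n)
     = (a + of_nat n) * (b + of_nat n) * fps_nth (hyper_fps a b c) n"
proof -
  have "rGamma (c + of_nat n) = (c + of_nat n) * rGamma (c + of_nat (Suc n))"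
    using rGamma_plus1[of "c + of_nat n"] by (simp add: add_ac)
  then show ?thesis
    by (simp add: hyper_fps_def pochhammer_Suc field_simps del: of_nat_Suc)
qed

section \<open>Limits of quotients linear in the index, and convergence of the series\<close>

lemma of_nat_add_at_infinity: "filterlim (\<lambda>n. of_nat n + y :: complex) at_infinity sequentially"
  using tendsto_add_filterlim_at_infinity'[OF tendsto_of_nat tendsto_const] .

lemma eventually_of_nat_add_neq_0: "eventually (\<lambda>n. of_nat n + y \<noteq> (0 :: complex)) sequentially"
  using of_nat_add_at_infinity eventually_not_equal_at_infinity[of 0]
  unfolding filterlim_iff by blast

lemma inverse_of_nat_add_tendsto_0: "(\<lambda>n. inverse (of_nat n + y :: complex)) \<longlonglongrightarrow> 0"
  by (rule filterlim_compose[OF tendsto_inverse_0 of_nat_add_at_infinity])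

lemma linear_ratio_tendsto_1: "(\<lambda>n. (of_nat n + x) / (of_nat n + y :: complex)) \<longlonglongrightarrow> 1"
proof -
  have "(\<lambda>n. 1 + (x - y) * inverse (of_nat n + y :: complex)) \<longlonglongrightarrow> 1 + (x - y) * 0"
    by (intro tendsto_intros inverse_of_nat_add_tendsto_0)
  moreover have "eventually
      (\<lambda>n. 1 + (x - y) * inverse (of_nat n + y) = (of_nat n + x) / (of_nat n + y)) sequentially"
    using eventually_of_nat_add_neq_0[of y] by eventually_elim (simp add: field_simps)
  ultimately show ?thesis by (simp add: tendsto_cong)
qed

lemma fps_conv_radius_hyper_fps: "fps_conv_radius (hyper_fps a b c) \<ge> 1"
proof (rule fps_conv_radius_ge_1I)
  fix \<delta> :: real assume d: "\<delta> > 0"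
  let ?f = "fps_nth (hyper_fps a b c)"
  let ?q = "\<lambda>n. (of_nat n + a) / (of_nat n + 1) * ((of_nat n + b) / (of_nat n + c))"
  have "?q \<longlonglongrightarrow> 1 * 1"
    by (intro tendsto_mult linear_ratio_tendsto_1)
  then have "(\<lambda>n. norm (?q n)) \<longlonglongrightarrow> norm (1 :: complex)" by (intro tendsto_norm) simp
  then have "eventually (\<lambda>n. norm (?q n) < 1 + \<delta>) sequentially"
    by (rule order_tendstoD) (use d in simp)
  moreover have "eventually (\<lambda>n. (of_nat n + c :: complex) \<noteq> 0) sequentially"
    by (rule eventually_of_nat_add_neq_0)
  ultimately have "eventually (\<lambda>n. norm (?f (Suc n)) \<le> (1 + \<delta>) * norm (?f n)) sequentially"
  proof eventually_elim
    case (elim n)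
    have "(of_nat n + 1 :: complex) \<noteq> 0"
      by (metis of_nat_Suc of_nat_neq_0 add.commute)
    then have "(of_nat n + 1) * (of_nat n + c) \<noteq> 0" using elim(2) by simp
    moreover have "(of_nat n + 1) * (of_nat n + c) * ?f (Suc n) = (of_nat n + a) * (of_nat n + b) * ?f n"
      using hyper_fps_Suc[of n c a b] by (simp add: add.commute)
    ultimately have "?f (Suc n) = ?q n * ?f n"
      by (simp add: eq_divide_eq mult.commute)
    then show ?case
      using mult_right_mono[OF less_imp_le[OF elim(1)] norm_ge_zero[of "?f n"]] by (metis norm_mult)
  qed
  then show "\<exists>S C. (\<forall>n. norm (?f n) \<le> C * S n) \<and> (\<forall>n. 0 \<le> S n) \<and>
             eventually (\<lambda>n. S (Suc n) \<le> (1 + \<delta>) * S n) sequentially"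
    by (intro exI[of _ "\<lambda>n. norm (?f n)"] exI[of _ 1]) auto
qed

text \<open>Gauss's hypergeometric equation. Its \<open>n\<close>-th coefficient is exactly
  \<open>hyper_fps_Suc\<close>.\<close>

lemma hyper_fps_ode:
  fixes a b c :: complex
  defines "f \<equiv> hyper_fps a b c"
  shows "fps_X * (1 - fps_X) * fps_deriv (fps_deriv f)
      + (fps_const c - fps_const (a + b + 1) * fps_X) * fps_deriv f - fps_const (a * b) * f = 0"
proof (rule fps_ext)
  fix n
  have "of_nat (Suc n) * (c + of_nat n) * fps_nth f (Suc n) = (a + of_nat n) * (b + of_nat n) * fps_nth f n"
    unfolding f_def by (rule hyper_fps_Suc)
  then show "fps_nth (fps_X * (1 - fps_X) * fps_deriv (fps_deriv f)
      + (fps_const c - fps_const (a + b + 1) * fps_X) * fps_deriv f - fps_const (a * b) * f) n = fps_nth 0 n"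
    by (cases n; cases "n - 1") (simp_all add: algebra_simps mult.assoc)
qed


text \<open>Equals \<open>-4 k(-u)\<close> for the Koebe function \<open>k(u) = u/(1-u)^2\<close>.
  The zero constant term makes formal composition with it meaningful.\<close>

definition koebe_fps :: "complex fps" where
  "koebe_fps = 4 * fps_X * inverse ((1 + fps_X)\<^sup>2)"

definition pullback_fps :: "complex \<Rightarrow> complex \<Rightarrow> complex \<Rightarrow> complex fps" where
  "pullback_fps a b c = hyper_fps a b c oo koebe_fps"

lemma koebe_fps_nth_0: "fps_nth koebe_fps 0 = 0"
  by (simp add: koebe_fps_def)

text \<open>Gauss's equation composed with \<open>Z = 4X/(1+X)^2\<close> and multiplied by
  \<open>4(1-X)\<close>. Since \<open>Z' = 4(1-X)/(1+X)^3\<close>, this factor expresses the first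
  derivative through \<open>G'\<close> without division, while
  \<open>1 - Z = ((1-X)/(1+X))^2\<close> absorbs the double zero of \<open>Z'^2\<close>.\<close>

lemma pullback_fps_ode:
  fixes a b c :: complex
  defines "G \<equiv> pullback_fps a b c" and "X \<equiv> fps_X :: complex fps"
  shows "X * (1 + X)^2 * (1 - X) * fps_deriv (fps_deriv G)
      + ((1 + X)^2 * (1 - X) + 2 * X * (1 + X) + (fps_const c - 1) * (1 + X)^3
          - 4 * (fps_const a + fps_const b) * X * (1 + X)) * fps_deriv G
      - 4 * (fps_const a * fps_const b) * (1 - X) * G = 0"
proof -
  define f where "f = hyper_fps a b c"
  \<comment> \<open>\<open>P\<close> stands for \<open>1/(1+X)\<close>: all derivatives of
    \<open>Z\<close> become polynomials in \<open>X\<close> and \<open>P\<close>, and the single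
    relation \<open>(1 + X) * P = 1\<close> leaves a purely algebraic claim.\<close>
  define P where "P = inverse (1 + X)"
  define Z where "Z = koebe_fps"
  have Z0: "fps_nth Z 0 = 0" by (simp add: Z_def koebe_fps_nth_0)
  have P: "(1 + X) * P = 1"
    unfolding P_def X_def by (subst mult.commute, rule inverse_mult_eq_1) simp
  have Z: "Z = 4 * X * P^2"
    by (simp add: Z_def koebe_fps_def P_def X_def fps_inverse_power)
  have dP: "fps_deriv P = - (P^2)"
    unfolding P_def X_def by (subst fps_inverse_deriv) (auto simp: power2_eq_square)
  have dX: "fps_deriv X = 1" by (simp add: X_def)
  have dZ: "fps_deriv Z = 4 * P^2 - 8 * X * P^3"
    by (simp add: Z dP dX power2_eq_square power3_eq_cube algebra_simps)
  have ddZ: "fps_deriv (fps_deriv Z) = - 16 * P^3 + 24 * X * P^4"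
    unfolding dZ by (simp add: dP dX power2_eq_square power3_eq_cube power4_eq_xxxx algebra_simps)
  define f0 f1 f2 where "f0 = f oo Z" and "f1 = fps_deriv f oo Z" and "f2 = fps_deriv (fps_deriv f) oo Z"
  have dG: "fps_deriv G = f1 * fps_deriv Z"
    unfolding G_def pullback_fps_def f_def[symmetric] Z_def[symmetric] f1_def
    by (rule fps_compose_deriv[OF Z0])
  have ddG: "fps_deriv (fps_deriv G) = f2 * (fps_deriv Z)^2 + f1 * fps_deriv (fps_deriv Z)"
    unfolding dG f1_def f2_def fps_deriv_mult fps_compose_deriv[OF Z0]
    by (simp add: power2_eq_square algebra_simps)
  have "(fps_X * (1 - fps_X) * fps_deriv (fps_deriv f)
      + (fps_const c - fps_const (a + b + 1) * fps_X) * fps_deriv f - fps_const (a * b) * f) oo Z = 0 oo Z"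
    unfolding f_def hyper_fps_ode ..
  then have ode: "Z * (1 - Z) * f2 + (fps_const c - (fps_const a + fps_const b + 1) * Z) * f1
      - (fps_const a * fps_const b) * f0 = 0"
    by (simp add: fps_compose_add_distrib fps_compose_sub_distrib fps_compose_mult_distrib[OF Z0] Z0
        f0_def f1_def f2_def flip: fps_const_add fps_const_mult)
  have G: "G = f0" by (simp add: G_def pullback_fps_def f0_def f_def Z_def)
  show ?thesis
    using P ode unfolding ddG unfolding dG unfolding ddZ unfolding dZ unfolding G Z
    by algebra
qed

text \<open>The coefficient of \<open>X^(n+2)\<close> in \<open>pullback_fps_ode\<close>. The
  quadratic parts are factored into linear terms \<open>of_nat n + x\<close>, including
  \<open>of_nat n + 0\<close>, to fit the limit argument that follows.\<close>

lemma pullback_fps_recurrence: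
  fixes a b c :: complex
  defines "g \<equiv> fps_nth (pullback_fps a b c)"
  shows "(of_nat n + 3) * (of_nat n + (2 + c)) * g (n + 3) =
     (4 * a * b - (of_nat n + 2) * (of_nat n + (1 + 3 * c - 4 * (a + b)))) * g (n + 2)
   + ((of_nat n + 1) * (of_nat n + (2 - 3 * c + 4 * (a + b))) - 4 * a * b) * g (n + 1)
   + (of_nat n + 0) * (of_nat n + (1 - c)) * g n"
proof -
  define G where "G = pullback_fps a b c"
  define G' where "G' = fps_deriv G"
  define G'' where "G'' = fps_deriv G'"
  let ?X = "fps_X :: complex fps"
  have "?X * (1 + ?X)^2 * (1 - ?X) * G''
      + ((1 + ?X)^2 * (1 - ?X) + 2 * ?X * (1 + ?X) + (fps_const c - 1) * (1 + ?X)^3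
          - 4 * (fps_const a + fps_const b) * ?X * (1 + ?X)) * G'
      - 4 * (fps_const a * fps_const b) * (1 - ?X) * G = 0"
    unfolding G_def G'_def G''_def by (rule pullback_fps_ode)
  \<comment> \<open>Sorted by monomials, so that taking a coefficient is a mere index shift.\<close>
  then have "?X^1 * G'' + ?X^2 * G'' - ?X^3 * G'' - ?X^4 * G''
     + fps_const c * (?X^0 * G') + (3 * fps_const c - 4 * (fps_const a + fps_const b)) * (?X^1 * G')
     + (3 * fps_const c - 2 - 4 * (fps_const a + fps_const b)) * (?X^2 * G')
     + (fps_const c - 2) * (?X^3 * G')
     - 4 * (fps_const a * fps_const b) * (?X^0 * G - ?X^1 * G) = 0"
    by algebra
  also have "3 * fps_const c - 4 * (fps_const a + fps_const b) = fps_const (3 * c - 4 * (a + b))"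
    by (simp add: numeral_fps_const)
  also have "3 * fps_const c - 2 - 4 * (fps_const a + fps_const b) = fps_const (3 * c - 2 - 4 * (a + b))"
    by (simp add: numeral_fps_const)
  also have "fps_const c - 2 = fps_const (c - 2)"
    by (simp add: numeral_fps_const)
  also have "4 * (fps_const a * fps_const b) = fps_const (4 * (a * b))"
    by (simp add: numeral_fps_const)
  finally have "fps_nth (?X^1 * G'' + ?X^2 * G'' - ?X^3 * G'' - ?X^4 * G''
     + fps_const c * (?X^0 * G') + fps_const (3 * c - 4 * (a + b)) * (?X^1 * G')
     + fps_const (3 * c - 2 - 4 * (a + b)) * (?X^2 * G')
     + fps_const (c - 2) * (?X^3 * G')
     - fps_const (4 * (a * b)) * (?X^0 * G - ?X^1 * G)) (n + 2) = 0"
    by simp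
  \<comment> \<open>Where a shift leaves the index range (\<open>n\<close> = 0 or 1), the true
    coefficient is 0, and so is the factor \<open>n\<close> or \<open>n (n - 1)\<close> on the
    right; the latter difference is complex and does not truncate.\<close>
  moreover have
     "fps_nth (?X^1 * G'') (n+2) = of_nat ((n+2)*(n+3)) * g (n+3)"
     "fps_nth (?X^2 * G'') (n+2) = of_nat ((n+1)*(n+2)) * g (n+2)"
     "fps_nth (?X^3 * G'') (n+2) = of_nat (n*(n+1)) * g (n+1)"
     "fps_nth (?X^4 * G'') (n+2) = of_nat n * (of_nat n - 1) * g n"
     "fps_nth (?X^0 * G') (n+2) = of_nat (n+3) * g (n+3)"
     "fps_nth (?X^1 * G') (n+2) = of_nat (n+2) * g (n+2)"
     "fps_nth (?X^2 * G') (n+2) = of_nat (n+1) * g (n+1)"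
     "fps_nth (?X^3 * G') (n+2) = of_nat n * g n"
     "fps_nth (?X^0 * G) (n+2) = g (n+2)"
     "fps_nth (?X^1 * G) (n+2) = g (n+1)"
    unfolding fps_X_power_mult_nth G''_def G'_def g_def G_def
    by (cases n; cases "n - 1"; simp add: numeral_2_eq_2 numeral_3_eq_3 algebra_simps)+
  ultimately have "of_nat ((n+2)*(n+3)) * g (n+3) + of_nat ((n+1)*(n+2)) * g (n+2)
     - of_nat (n*(n+1)) * g (n+1) - of_nat n * (of_nat n - 1) * g n
     + c * (of_nat (n+3) * g (n+3)) + (3 * c - 4 * (a + b)) * (of_nat (n+2) * g (n+2))
     + (3 * c - 2 - 4 * (a + b)) * (of_nat (n+1) * g (n+1))
     + (c - 2) * (of_nat n * g n)
     - 4 * (a * b) * (g (n+2) - g (n+1)) = 0"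
    by (simp only: fps_add_nth fps_sub_nth fps_mult_left_const_nth)
  then show ?thesis
    by (simp only: of_nat_add of_nat_mult of_nat_numeral of_nat_1) algebra
qed

lemma fps_conv_radius_pullback_fps: "fps_conv_radius (pullback_fps a b c) \<ge> 1"
proof -
  define g where "g = fps_nth (pullback_fps a b c)"
  \<comment> \<open>Common shape of the three coefficients after division by
    \<open>(n + 3) (n + 2 + c)\<close>; the limits \<open>s\<close> are -1, 1 and 1.\<close>
  have quot: "(\<lambda>n. k * (inverse (of_nat n + 3) * inverse (of_nat n + (2 + c)))
        + s * ((of_nat n + x) / (of_nat n + 3) * ((of_nat n + y) / (of_nat n + (2 + c))))) \<longlonglongrightarrow> s" for k s x y
  proof -
    have "(\<lambda>n. k * (inverse (of_nat n + 3) * inverse (of_nat n + (2 + c)))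
        + s * ((of_nat n + x) / (of_nat n + 3) * ((of_nat n + y) / (of_nat n + (2 + c)))))
      \<longlonglongrightarrow> k * (0 * 0) + s * (1 * 1)"
      by (intro tendsto_intros inverse_of_nat_add_tendsto_0 linear_ratio_tendsto_1)
    then show ?thesis by simp
  qed
  show ?thesis
  proof (rule fps_conv_radius_ge_1_recurrence[OF quot quot quot])
    show "eventually (\<lambda>n. fps_nth (pullback_fps a b c) (n + 3) =
       (4 * a * b * (inverse (of_nat n + 3) * inverse (of_nat n + (2 + c)))
        + (-1) * ((of_nat n + 2) / (of_nat n + 3) * ((of_nat n + (1 + 3 * c - 4 * (a + b))) / (of_nat n + (2 + c)))))
          * fps_nth (pullback_fps a b c) (n + 2)
     + (- 4 * a * b * (inverse (of_nat n + 3) * inverse (of_nat n + (2 + c)))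
        + 1 * ((of_nat n + 1) / (of_nat n + 3) * ((of_nat n + (2 - 3 * c + 4 * (a + b))) / (of_nat n + (2 + c)))))
          * fps_nth (pullback_fps a b c) (n + 1)
     + (0 * (inverse (of_nat n + 3) * inverse (of_nat n + (2 + c)))
        + 1 * ((of_nat n + 0) / (of_nat n + 3) * ((of_nat n + (1 - c)) / (of_nat n + (2 + c)))))
          * fps_nth (pullback_fps a b c) n) sequentially"
      using eventually_of_nat_add_neq_0[of 3] eventually_of_nat_add_neq_0[of "2 + c"]
    proof eventually_elim
      case (elim n)
      define p q where "p = of_nat n + (3::complex)" and "q = of_nat n + (2 + c)"
      have pq: "p \<noteq> 0" "q \<noteq> 0" using elim by (auto simp: p_def q_def)
      have r: "p * q * g (n + 3) =
         (4 * a * b - (of_nat n + 2) * (of_nat n + (1 + 3 * c - 4 * (a + b)))) * g (n + 2)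
       + ((of_nat n + 1) * (of_nat n + (2 - 3 * c + 4 * (a + b))) - 4 * a * b) * g (n + 1)
       + (of_nat n + 0) * (of_nat n + (1 - c)) * g n"
        unfolding p_def q_def g_def by (rule pullback_fps_recurrence)
      have "g (n + 3) = (p * q * g (n + 3)) / (p * q)" using pq by simp
      then show ?case
        unfolding g_def[symmetric] r unfolding p_def[symmetric] q_def[symmetric]
        using pq by (simp add: divide_inverse algebra_simps)
    qed
  qed
qed

subsection \<open>Analytic continuation\<close>

text \<open>The cut in the form of the branch cut of \<open>csqrt\<close>, which is later applied to
  \<open>1 - z\<close>.\<close>

lemma mem_hypergeo_domain_iff: "z \<in> hypergeo_domain \<longleftrightarrow> 1 - z \<notin> \<real>\<^sub>\<le>\<^sub>0"
proof -
  have "z \<in> complex_of_real ` {1..} \<longleftrightarrow> Im z = 0 \<and> Re z \<ge> 1"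
    by (auto simp: complex_eq_iff intro!: image_eqI[of _ _ "Re z"])
  then show ?thesis by (auto simp: hypergeo_domain_def complex_nonpos_Reals_iff)
qed

lemma open_hypergeo_domain: "open hypergeo_domain"
proof -
  have "hypergeo_domain = (\<lambda>z. 1 - z) -` (- \<real>\<^sub>\<le>\<^sub>0)"
    by (auto simp: mem_hypergeo_domain_iff)
  then show ?thesis
    by (rule ssubst) (intro open_vimage continuous_intros open_Compl closed_nonpos_Reals_complex)
qed

lemma zero_in_hypergeo_domain: "0 \<in> hypergeo_domain"
  by (simp add: mem_hypergeo_domain_iff)

lemma connected_hypergeo_domain: "connected hypergeo_domain"
proof (rule starlike_imp_connected)
  show "starlike hypergeo_domain"
    unfolding starlike_def
  proof (intro bexI[OF _ zero_in_hypergeo_domain] ballI subsetI)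
    fix x z assume x: "x \<in> hypergeo_domain" and "z \<in> closed_segment 0 x"
    then obtain t where t: "0 \<le> t" "t \<le> 1" "z = of_real t * x"
      by (auto simp: in_segment scaleR_conv_of_real)
    show "z \<in> hypergeo_domain"
    proof (cases "Im x = 0")
      case True
      then have "Re x < 1" using x by (auto simp: mem_hypergeo_domain_iff complex_nonpos_Reals_iff)
      then have "t * Re x < 1"
        using t(1,2) mult_right_mono[of t 1 "Re x"] mult_nonneg_nonpos[of t "Re x"]
        by (cases "Re x \<ge> 0") auto
      then show ?thesis using t True by (auto simp: mem_hypergeo_domain_iff complex_nonpos_Reals_iff)
    next
      case False
      then show ?thesis using t
        by (cases "t = 0") (auto simp: mem_hypergeo_domain_iff complex_nonpos_Reals_iff)
    qed
  qed
qed

lemma ball_subset_hypergeo_domain: "ball 0 1 \<subseteq> hypergeo_domain"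
proof
  fix z :: complex assume "z \<in> ball 0 1"
  then have "Re z < 1" using complex_Re_le_cmod[of z] by simp
  then show "z \<in> hypergeo_domain" by (auto simp: mem_hypergeo_domain_iff complex_nonpos_Reals_iff)
qed

lemma hypergeo_series_eq_eval_fps: "hypergeo_series a b c z = eval_fps (hyper_fps a b c) z"
  by (simp add: hypergeo_series_def eval_fps_def hyper_fps_def)

text \<open>The Cayley transform sends the right half-plane into the unit disc, because
  \<open>|1+s|^2 - |1-s|^2 = 4 Re s\<close>.\<close>

lemma norm_cayley_less_1:
  fixes s :: complex
  assumes "Re s > 0"
  shows "norm ((1 - s) / (1 + s)) < 1"
proof -
  have "(norm (1 - s))\<^sup>2 < (norm (1 + s))\<^sup>2"
    unfolding cmod_power2 using assms by (simp add: power2_eq_square algebra_simps)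
  then have "norm (1 - s) < norm (1 + s)" by (rule power2_less_imp_less) simp
  moreover have "norm (1 + s) > 0" using calculation norm_ge_zero[of "1 - s"] by linarith
  ultimately show ?thesis by (simp add: norm_divide)
qed

lemma hypergeo_continuation_exists:
  "\<exists>f. f holomorphic_on hypergeo_domain \<and> (\<forall>z. norm z < 1 \<longrightarrow> f z = hypergeo_series a b c z)"
proof -
  define u where "u z = (1 - csqrt (1 - z)) / (1 + csqrt (1 - z))" for z
  define G where "G = pullback_fps a b c"
  define F where "F = hyper_fps a b c"
  \<comment> \<open>The principal root has nonnegative real part. Were it purely imaginary, its
    square \<open>1 - z\<close> would be a nonpositive real, placing \<open>z\<close> on the
    cut.\<close>
  have s: "Re (csqrt (1 - z)) > 0" if "z \<in> hypergeo_domain" for z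
  proof (rule ccontr)
    assume "\<not> Re (csqrt (1 - z)) > 0"
    then have "Re (csqrt (1 - z)) = 0" using csqrt_principal[of "1 - z"] by linarith
    then have "(csqrt (1 - z))\<^sup>2 \<in> \<real>\<^sub>\<le>\<^sub>0"
      by (simp add: complex_nonpos_Reals_iff Re_power2 Im_power2 del: csqrt.simps power2_csqrt)
    with that show False by (simp add: mem_hypergeo_domain_iff)
  qed
  have s1: "1 + csqrt (1 - z) \<noteq> 0" if "z \<in> hypergeo_domain" for z
    using s[OF that] by (auto simp: add_eq_0_iff simp del: csqrt.simps)
  have u_less: "norm (u z) < 1" if "z \<in> hypergeo_domain" for z
    unfolding u_def by (rule norm_cayley_less_1[OF s[OF that]])
  have u_hol: "u holomorphic_on hypergeo_domain"
    unfolding u_def using s1 by (auto intro!: holomorphic_intros simp: mem_hypergeo_domain_iff)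
  have u_inv: "4 * u z * inverse ((1 + u z)\<^sup>2) = z" if "z \<in> hypergeo_domain" for z
  proof -
    define q where "q = csqrt (1 - z)"
    have z: "z = 1 - q\<^sup>2" by (simp add: q_def)
    have q: "1 + q \<noteq> 0" using s1[OF that] by (simp add: q_def)
    have "1 + u z = 2 / (1 + q)" unfolding u_def q_def[symmetric] using q by (simp add: field_simps)
    then have "4 * u z * inverse ((1 + u z)\<^sup>2) = 4 * ((1 - q) / (1 + q)) * ((1 + q)\<^sup>2 / 4)"
      by (simp add: u_def q_def power_divide)
    also have "\<dots> = (1 - q) * (1 + q)" using q by (simp add: power2_eq_square)
    finally show ?thesis by (simp add: z power2_eq_square algebra_simps)
  qed
  have "ball 0 1 \<subseteq> eball 0 (fps_conv_radius G)"
    unfolding G_def using fps_conv_radius_pullback_fps[of a b c]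
    by (intro ball_eball_mono) (simp add: one_ereal_def)
  then have K_hol: "(eval_fps G \<circ> u) holomorphic_on hypergeo_domain"
    using u_less by (intro holomorphic_on_compose_gen[OF u_hol, of _ "ball 0 1"] holomorphic_on_eval_fps) auto
  have G_pos: "fps_conv_radius G > 0" and F_pos: "fps_conv_radius F > 0"
    using fps_conv_radius_pullback_fps[of a b c] fps_conv_radius_hyper_fps[of a b c]
    by (auto simp: G_def F_def intro: less_le_trans[of 0 1])
  have "(\<lambda>x::complex. 4 * x * inverse ((1 + x)\<^sup>2)) has_fps_expansion koebe_fps"
    unfolding koebe_fps_def by (intro fps_expansion_intros) (auto simp: fps_nth_power_0)
  \<comment> \<open>Formal composition matches composition of germs, so \<open>G\<close> sums near 0
    to the series evaluated at \<open>4x/(1+x)^2\<close>.\<close>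
  then have "(eval_fps F \<circ> (\<lambda>x. 4 * x * inverse ((1 + x)\<^sup>2))) has_fps_expansion G"
    unfolding G_def pullback_fps_def F_def[symmetric]
    by (intro has_fps_expansion_compose eval_fps_has_fps_expansion F_pos koebe_fps_nth_0)
  then have "eventually (\<lambda>x. eval_fps G x = eval_fps F (4 * x * inverse ((1 + x)\<^sup>2))) (nhds 0)"
    by (simp add: has_fps_expansion_def)
  \<comment> \<open>As \<open>u z\<close> tends to 0 with \<open>z\<close>, the identity near 0 may
    be evaluated at \<open>u z\<close>, where \<open>u_inv\<close> returns \<open>z\<close>.\<close>
  moreover have "filterlim u (nhds 0) (nhds 0)"
  proof -
    have "isCont u 0"
      using holomorphic_on_imp_continuous_on[OF u_hol] open_hypergeo_domain zero_in_hypergeo_domain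
      by (simp add: continuous_on_eq_continuous_at)
    moreover have "u 0 = 0" by (simp add: u_def)
    ultimately show ?thesis using tendsto_at_iff_tendsto_nhds[of u 0] by (simp add: isCont_def)
  qed
  ultimately have "eventually (\<lambda>z. eval_fps G (u z) = eval_fps F (4 * u z * inverse ((1 + u z)\<^sup>2))) (nhds 0)"
    by (rule eventually_compose_filterlim)
  moreover have "eventually (\<lambda>z. z \<in> hypergeo_domain) (nhds 0)"
    using open_hypergeo_domain zero_in_hypergeo_domain by (rule eventually_nhds_in_open)
  ultimately have "eventually (\<lambda>z. eval_fps F z = (eval_fps G \<circ> u) z) (nhds 0)"
    by eventually_elim (simp add: u_inv)
  then have "(eval_fps G \<circ> u) has_fps_expansion F"
    using F_pos by (simp add: has_fps_expansion_def)
  moreover have "(eval_fps G \<circ> u) holomorphic_on ball 0 1"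
    using K_hol ball_subset_hypergeo_domain by (rule holomorphic_on_subset)
  \<comment> \<open>Agreement near 0 makes \<open>F\<close> the Taylor series of the continuation,
    and holomorphy on the disc extends the equality to all of it.\<close>
  ultimately have "\<forall>z. norm z < 1 \<longrightarrow> (eval_fps G \<circ> u) z = hypergeo_series a b c z"
    unfolding hypergeo_series_eq_eval_fps F_def
    by (metis has_fps_expansion_imp_eval_fps_eq)
  with K_hol show ?thesis by blast
qed

section \<open>The continued function and the identity theorem\<close>

lemma hypergeo_holomorphic: "hypergeo a b c holomorphic_on hypergeo_domain"
  and hypergeo_eq_series: "norm z < 1 \<Longrightarrow> hypergeo a b c z = hypergeo_series a b c z"
  using someI_ex[OF hypergeo_continuation_exists[of a b c]] unfolding hypergeo_def by auto

text \<open>An equality of functions, valid even on the cut: both sides choose from the same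
  predicate, which is symmetric in \<open>a\<close> and \<open>b\<close>.\<close>

lemma hypergeo_commute: "hypergeo a b c = hypergeo b a c"
  unfolding hypergeo_def hypergeo_series_def by (simp add: mult.commute[of "pochhammer a _"])

lemma hypergeo_has_fps_expansion: "hypergeo a b c has_fps_expansion hyper_fps a b c"
proof -
  have "eventually (\<lambda>z::complex. z \<in> ball 0 1) (nhds 0)"
    by (rule eventually_nhds_in_open) auto
  then have "eventually (\<lambda>z. eval_fps (hyper_fps a b c) z = hypergeo a b c z) (nhds 0)"
    by eventually_elim (simp add: hypergeo_eq_series hypergeo_series_eq_eval_fps)
  moreover have "fps_conv_radius (hyper_fps a b c) > 0"
    using fps_conv_radius_hyper_fps by (rule less_le_trans[rotated]) simp
  ultimately show ?thesis by (simp add: has_fps_expansion_def)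
qed

text \<open>The identity theorem on the connected slit plane; it reduces relations between functions
  to relations between formal power series.\<close>

lemma hypergeo_domain_eqI:
  assumes "f holomorphic_on hypergeo_domain" "g holomorphic_on hypergeo_domain"
    and "f has_fps_expansion F" "g has_fps_expansion F" "z \<in> hypergeo_domain"
  shows "f z = g z"
proof -
  have "(\<lambda>z. f z - g z) has_fps_expansion F - F"
    by (intro fps_expansion_intros assms)
  then have "f z - g z = 0"
    using assms open_hypergeo_domain connected_hypergeo_domain zero_in_hypergeo_domain
    by (intro has_fps_expansion_0_analytic_continuation[of "\<lambda>z. f z - g z" hypergeo_domain z])
       (auto intro!: holomorphic_intros)
  then show ?thesis by simp
qed

lemmas hypergeo_holomorphic_intros =
  holomorphic_intros hypergeo_holomorphic holomorphic_deriv[OF hypergeo_holomorphic open_hypergeo_domain]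

lemmas hypergeo_fps_intros = fps_expansion_intros hypergeo_has_fps_expansion

subsection \<open>Contiguous relations\<close>

text \<open>The part of the coefficient free of \<open>a\<close> and \<open>b\<close>. Once it is
  split off, parameter shifts act by linear factors, and each contiguous relation becomes a
  polynomial identity.\<close>

definition hyper_weight :: "complex \<Rightarrow> nat \<Rightarrow> complex" where
  "hyper_weight c n = rGamma (c + of_nat n) * inverse (fact n)"

lemma hyper_fps_nth: "fps_nth (hyper_fps a b c) n = pochhammer a n * pochhammer b n * hyper_weight c n"
  by (simp add: hyper_fps_def hyper_weight_def divide_inverse mult.assoc)

lemma inverse_fact_Suc: "inverse (fact n :: complex) = (of_nat n + 1) * inverse (fact (Suc n))"
  by (simp add: field_simps del: of_nat_Suc) (simp add: algebra_simps)

lemma rGamma_of_nat_Suc: "rGamma (c + of_nat n) = (c + of_nat n) * rGamma (c + of_nat (Suc n))"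
  using rGamma_plus1[of "c + of_nat n"] by (simp add: add_ac)

text \<open>Goes from index \<open>n\<close> up to \<open>Suc n\<close>: the opposite direction
  would divide by \<open>c + of_nat n\<close>, which may be 0.\<close>

lemma hyper_weight_Suc: "hyper_weight c n = (c + of_nat n) * (of_nat n + 1) * hyper_weight c (Suc n)"
  unfolding hyper_weight_def rGamma_of_nat_Suc[of c n] inverse_fact_Suc[of n] by simp

lemma hyper_weight_minus1: "hyper_weight (c - 1) n = (c - 1 + of_nat n) * hyper_weight c n"
  unfolding hyper_weight_def using rGamma_of_nat_Suc[of "c - 1" n] by simp

lemma hyper_weight_plus1: "hyper_weight (c + 1) n = (of_nat n + 1) * hyper_weight c (Suc n)"
  unfolding hyper_weight_def inverse_fact_Suc[of n] by (simp add: add_ac)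

lemma pochhammer_minus1_Suc: "pochhammer (a - 1 :: complex) (Suc n) = (a - 1) * pochhammer a n"
  by (simp add: pochhammer_rec)

lemma pochhammer_plus1: "a * pochhammer (a + 1 :: complex) n = pochhammer a n * (a + of_nat n)"
  by (metis pochhammer_rec pochhammer_Suc)

lemma fps_deriv_hyper_fps:
  "fps_deriv (hyper_fps a b c) = fps_const (a * b) * hyper_fps (a + 1) (b + 1) (c + 1)"
proof (rule fps_ext)
  fix n
  have "fps_nth (fps_deriv (hyper_fps a b c)) n =
      pochhammer a (Suc n) * pochhammer b (Suc n) * ((of_nat n + 1) * hyper_weight c (Suc n))"
    by (simp add: hyper_fps_nth algebra_simps)
  also have "\<dots> = (a * pochhammer (a + 1) n) * (b * pochhammer (b + 1) n) * hyper_weight (c + 1) n"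
    by (simp add: pochhammer_rec hyper_weight_plus1)
  finally show "fps_nth (fps_deriv (hyper_fps a b c)) n
      = fps_nth (fps_const (a * b) * hyper_fps (a + 1) (b + 1) (c + 1)) n"
    by (simp add: hyper_fps_nth)
qed

text \<open>For Gegenbauer parameters this is the shift of \<alpha> to \<open>\<alpha> - 1\<close>
  with \<open>l\<close> fixed.\<close>

lemma hyper_fps_lower_all:
  "fps_X * (1 - fps_X) * fps_deriv (hyper_fps a b c)
      + (fps_const (c - 1) - fps_const (a + b - 1) * fps_X) * hyper_fps a b c
    = hyper_fps (a - 1) (b - 1) (c - 1)" (is "?L = ?R")
proof (rule fps_ext)
  fix n
  show "fps_nth ?L n = fps_nth ?R n"
  proof (cases n)
    case 0
    then show ?thesis using hyper_weight_minus1[of c 0] by (simp add: hyper_fps_nth)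
  next
    case (Suc m)
    have "fps_nth ?L n = (c + of_nat m) * fps_nth (hyper_fps a b c) (Suc m)
        - (of_nat m + a + b - 1) * fps_nth (hyper_fps a b c) m"
      unfolding Suc by (cases m) (simp_all add: algebra_simps)
    \<comment> \<open>Every term is a multiple of
      \<open>pochhammer a m * pochhammer b m * hyper_weight c (Suc m)\<close>.\<close>
    also have "\<dots> = fps_nth ?R n"
      unfolding Suc hyper_fps_nth pochhammer_minus1_Suc
      unfolding hyper_weight_minus1 pochhammer_Suc hyper_weight_Suc[of c m] of_nat_Suc
      by algebra
    finally show ?thesis .
  qed
qed

text \<open>The constraint \<open>2c = a + b + 1\<close> is the Gegenbauer case: it holds for \<open>a, b = 1/2 + \<alpha> \<mp> \<lambda>\<close>, \<open>c = \<alpha> + 1\<close>.\<close>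
lemma hyper_fps_lower_first_raise_second:
  assumes "2 * c = a + b + 1"
  shows "2 * fps_X * (1 - fps_X) * fps_deriv (hyper_fps a b c)
      + fps_const b * (1 - 2 * fps_X) * hyper_fps a b c
    = fps_const b * hyper_fps (a - 1) (b + 1) c" (is "?L = ?R")
proof (rule fps_ext)
  fix n
  show "fps_nth ?L n = fps_nth ?R n"
  proof (cases n)
    case 0
    then show ?thesis by (simp add: hyper_fps_nth mult.assoc)
  next
    case (Suc m)
    have "fps_nth ?L n = (2 * of_nat m + 2 + b) * fps_nth (hyper_fps a b c) (Suc m)
        - 2 * (of_nat m + b) * fps_nth (hyper_fps a b c) m"
      unfolding Suc by (cases m) (simp_all add: mult.assoc algebra_simps numeral_fps_const)
    \<comment> \<open>The factor \<open>b\<close> is kept next to \<open>pochhammer (b + 1)\<close>,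
      so \<open>pochhammer_plus1\<close> applies without dividing by \<open>b\<close>.\<close>
    also have "\<dots> = pochhammer (a - 1) (Suc m) * (b * pochhammer (b + 1) (Suc m)) * hyper_weight c (Suc m)"
      using assms
      unfolding hyper_fps_nth pochhammer_minus1_Suc pochhammer_plus1
      unfolding pochhammer_Suc hyper_weight_Suc[of c m] of_nat_Suc
      by algebra
    also have "\<dots> = fps_nth ?R n"
      unfolding Suc by (simp add: hyper_fps_nth)
    finally show ?thesis .
  qed
qed

text \<open>The shift of \<open>(\<alpha>, l)\<close> to \<open>(\<alpha> + 1, l - 1)\<close>;
  \<open>2 * fps_X - 1\<close> represents \<open>-w\<close>. After the common factors are removed,
  the claim is \<open>2 (c + n) - (b + n) = a + 1 + n\<close>, which is the constraint.\<close>

lemma hyper_fps_raise_first_twice: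
  assumes "2 * c = a + b + 1"
  shows "(2 * fps_X - 1) * fps_deriv (hyper_fps a b c) + fps_const (2 * a) * hyper_fps a b c
    = fps_const (a * (a + 1)) * hyper_fps (a + 2) b (c + 1)" (is "?L = ?R")
proof (rule fps_ext)
  fix n
  have "fps_nth ?L n = 2 * (of_nat n + a) * fps_nth (hyper_fps a b c) n
      - (of_nat n + 1) * fps_nth (hyper_fps a b c) (Suc n)"
    by (cases n) (simp_all add: mult.assoc algebra_simps numeral_fps_const)
  also have "\<dots> = pochhammer a (Suc (Suc n)) * pochhammer b n * hyper_weight (c + 1) n"
    using assms
    unfolding hyper_fps_nth hyper_weight_plus1 pochhammer_Suc hyper_weight_Suc[of c n] of_nat_Suc
    by algebra
  also have "\<dots> = fps_nth ?R n"
    by (simp add: pochhammer_rec hyper_fps_nth add.assoc)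
  finally show "fps_nth ?L n = fps_nth ?R n" .
qed

text \<open>The shift of \<open>(\<alpha>, l)\<close> to \<open>(\<alpha> - 1, l + 1)\<close>, with
  \<open>1 - 2 * fps_X\<close> in the role of \<open>w\<close>.\<close>

lemma hyper_fps_lower_first_twice:
  assumes "2 * c = a + b + 1"
  shows "fps_X * (1 - fps_X) * (1 - 2 * fps_X) * fps_deriv (hyper_fps a b c)
      + (fps_const (2 * (a - 1)) * fps_X * (1 - fps_X) + fps_const (c - 1) * (1 - 2 * fps_X)\<^sup>2) * hyper_fps a b c
    = hyper_fps (a - 2) b (c - 1)" (is "?L = ?R")
proof (rule fps_ext)
  fix n
  let ?f = "hyper_fps a b c"
  \<comment> \<open>The factor multiplying \<open>?f\<close> expands to
    \<open>(c - 1) + \<kappa> X - \<kappa> X^2\<close>.\<close>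
  define \<kappa> where "\<kappa> = 2 * (a - 1) - 4 * (c - 1)"
  have "?L = fps_X^1 * fps_deriv ?f - fps_const 3 * (fps_X^2 * fps_deriv ?f) + fps_const 2 * (fps_X^3 * fps_deriv ?f)
     + fps_const (c - 1) * ?f + fps_const \<kappa> * (fps_X^1 * ?f) - fps_const \<kappa> * (fps_X^2 * ?f)"
    by (simp add: \<kappa>_def numeral_fps_const[symmetric] flip: fps_const_sub fps_const_mult fps_const_add) algebra
  then have L: "fps_nth ?L n = fps_nth (fps_X^1 * fps_deriv ?f) n - 3 * fps_nth (fps_X^2 * fps_deriv ?f) n
     + 2 * fps_nth (fps_X^3 * fps_deriv ?f) n + (c - 1) * fps_nth ?f n
     + \<kappa> * fps_nth (fps_X^1 * ?f) n - \<kappa> * fps_nth (fps_X^2 * ?f) n"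
    by (simp only: fps_add_nth fps_sub_nth fps_mult_left_const_nth)
  \<comment> \<open>The relation links three consecutive coefficients, so the generic case starts at
    \<open>n = 2\<close>.\<close>
  consider "n = 0" | "n = 1" | m where "n = Suc (Suc m)" by (cases n; cases "n - 1") auto
  then show "fps_nth ?L n = fps_nth ?R n"
  proof cases
    case 1
    then show ?thesis unfolding L unfolding fps_X_power_mult_nth using hyper_weight_minus1[of c 0]
      by (simp add: hyper_fps_nth)
  next
    case 2
    have "fps_nth ?L n = c * fps_nth ?f (Suc 0) + \<kappa> * fps_nth ?f 0"
      unfolding L unfolding fps_X_power_mult_nth 2 by (simp add: algebra_simps)
    also have "\<dots> = fps_nth ?R n"
      using assms
      unfolding 2 One_nat_def hyper_fps_nth hyper_weight_minus1 pochhammer_Suc pochhammer_0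
        hyper_weight_Suc[of c 0] \<kappa>_def
        of_nat_Suc of_nat_0
      by algebra
    finally show ?thesis .
  next
    case (3 m)
    have "fps_nth ?L n = (c + of_nat m + 1) * fps_nth ?f (Suc (Suc m))
        + (\<kappa> - 3 * (of_nat m + 1)) * fps_nth ?f (Suc m) + (2 * of_nat m - \<kappa>) * fps_nth ?f m"
      unfolding L unfolding fps_X_power_mult_nth 3
      by (cases m) (simp_all add: numeral_2_eq_2 numeral_3_eq_3 algebra_simps)
    also have "\<dots> = (a - 2) * (a - 1) * pochhammer a m * pochhammer b (Suc (Suc m))
        * hyper_weight (c - 1) (Suc (Suc m))"
      using assms
      unfolding hyper_fps_nth hyper_weight_minus1 pochhammer_Suc hyper_weight_Suc[of c m]
        hyper_weight_Suc[of c "Suc m"] \<kappa>_def of_nat_Suc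
      by algebra
    also have "(a - 2) * (a - 1) * pochhammer a m = pochhammer (a - 2) (Suc (Suc m))"
      by (simp add: pochhammer_rec add.assoc[symmetric])
    also have "\<dots> * pochhammer b (Suc (Suc m)) * hyper_weight (c - 1) (Suc (Suc m)) = fps_nth ?R n"
      unfolding 3 hyper_fps_nth ..
    finally show ?thesis .
  qed
qed

section \<open>Transfer of the contiguous relations to the slit plane\<close>

context
  fixes z :: complex
  assumes z: "z \<in> hypergeo_domain"
begin

lemma deriv_hypergeo:
  "deriv (hypergeo a b c) z = a * b * hypergeo (a + 1) (b + 1) (c + 1) z"
proof (rule hypergeo_domain_eqI[OF _ _ _ _ z])
  show "deriv (hypergeo a b c) has_fps_expansion fps_const (a * b) * hyper_fps (a + 1) (b + 1) (c + 1)"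
    unfolding fps_deriv_hyper_fps[symmetric] by (intro hypergeo_fps_intros)
qed (intro hypergeo_holomorphic_intros hypergeo_fps_intros)+

lemma hypergeo_lower_all:
  "z * (1 - z) * deriv (hypergeo a b c) z + (c - 1 - (a + b - 1) * z) * hypergeo a b c z
     = hypergeo (a - 1) (b - 1) (c - 1) z"
proof (rule hypergeo_domain_eqI[OF _ _ _ _ z])
  show "(\<lambda>z. z * (1 - z) * deriv (hypergeo a b c) z + (c - 1 - (a + b - 1) * z) * hypergeo a b c z)
     has_fps_expansion hyper_fps (a - 1) (b - 1) (c - 1)"
    unfolding hyper_fps_lower_all[symmetric] by (intro hypergeo_fps_intros)
qed (intro hypergeo_holomorphic_intros hypergeo_fps_intros)+

lemma hypergeo_lower_first_raise_second:
  assumes "2 * c = a + b + 1"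
  shows "2 * z * (1 - z) * deriv (hypergeo a b c) z + b * (1 - 2 * z) * hypergeo a b c z
     = b * hypergeo (a - 1) (b + 1) c z"
proof (rule hypergeo_domain_eqI[OF _ _ _ _ z])
  show "(\<lambda>z. 2 * z * (1 - z) * deriv (hypergeo a b c) z + b * (1 - 2 * z) * hypergeo a b c z)
     has_fps_expansion fps_const b * hyper_fps (a - 1) (b + 1) c"
    unfolding hyper_fps_lower_first_raise_second[OF assms, symmetric] by (intro hypergeo_fps_intros)
qed (intro hypergeo_holomorphic_intros hypergeo_fps_intros)+

lemma hypergeo_raise_first_twice:
  assumes "2 * c = a + b + 1"
  shows "(2 * z - 1) * deriv (hypergeo a b c) z + 2 * a * hypergeo a b c z
     = a * (a + 1) * hypergeo (a + 2) b (c + 1) z"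
proof (rule hypergeo_domain_eqI[OF _ _ _ _ z])
  show "(\<lambda>z. (2 * z - 1) * deriv (hypergeo a b c) z + 2 * a * hypergeo a b c z)
     has_fps_expansion fps_const (a * (a + 1)) * hyper_fps (a + 2) b (c + 1)"
    unfolding hyper_fps_raise_first_twice[OF assms, symmetric] by (intro hypergeo_fps_intros)
qed (intro hypergeo_holomorphic_intros hypergeo_fps_intros)+

lemma hypergeo_lower_first_twice:
  assumes "2 * c = a + b + 1"
  shows "z * (1 - z) * (1 - 2 * z) * deriv (hypergeo a b c) z
      + (2 * (a - 1) * z * (1 - z) + (c - 1) * (1 - 2 * z)\<^sup>2) * hypergeo a b c z
     = hypergeo (a - 2) b (c - 1) z"
proof (rule hypergeo_domain_eqI[OF _ _ _ _ z])
  show "(\<lambda>z. z * (1 - z) * (1 - 2 * z) * deriv (hypergeo a b c) z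
      + (2 * (a - 1) * z * (1 - z) + (c - 1) * (1 - 2 * z)\<^sup>2) * hypergeo a b c z)
     has_fps_expansion hyper_fps (a - 2) b (c - 1)"
    unfolding hyper_fps_lower_first_twice[OF assms, symmetric] by (intro hypergeo_fps_intros)
qed (intro hypergeo_holomorphic_intros hypergeo_fps_intros)+

end

subsection \<open>The Gegenbauer function\<close>

lemma deriv_gegenbauer_S:
  assumes "(1 - w) / 2 \<in> hypergeo_domain"
  shows "deriv (gegenbauer_S \<alpha> l) w
    = - (1/2) * deriv (hypergeo (1/2 + \<alpha> - l) (1/2 + \<alpha> + l) (\<alpha> + 1)) ((1 - w) / 2)"
proof -
  let ?h = "hypergeo (1/2 + \<alpha> - l) (1/2 + \<alpha> + l) (\<alpha> + 1)"
  have "(?h has_field_derivative deriv ?h ((1 - w) / 2)) (at ((1 - w) / 2))"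
    using hypergeo_holomorphic open_hypergeo_domain assms by (rule holomorphic_derivI)
  moreover have "((\<lambda>w. (1 - w) / 2) has_field_derivative - (1/2)) (at w)"
    by (auto intro!: derivative_eq_intros)
  ultimately have "((\<lambda>w. ?h ((1 - w) / 2)) has_field_derivative deriv ?h ((1 - w) / 2) * - (1/2)) (at w)"
    by (rule DERIV_chain2)
  moreover have "gegenbauer_S \<alpha> l = (\<lambda>w. ?h ((1 - w) / 2))" by (simp add: gegenbauer_S_def fun_eq_iff)
  ultimately show ?thesis by (simp add: DERIV_imp_deriv mult.commute)
qed

theorem mainTheorem3:
  fixes \<alpha> l w :: complex
  assumes "w \<in> - (complex_of_real ` {..-1})"
  shows
    "deriv (gegenbauer_S \<alpha> l) w
        = - (1/2) * (1/2 + \<alpha> - l) * (1/2 + \<alpha> + l) * gegenbauer_S (\<alpha> + 1) l w \<and>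
     (1 - w^2) * deriv (gegenbauer_S \<alpha> l) w - 2 * \<alpha> * w * gegenbauer_S \<alpha> l w
        = - 2 * gegenbauer_S (\<alpha> - 1) l w \<and>
     (1 - w^2) * deriv (gegenbauer_S \<alpha> l) w - (1/2 + \<alpha> + l) * w * gegenbauer_S \<alpha> l w
        = - (1/2 + \<alpha> + l) * gegenbauer_S \<alpha> (l + 1) w \<and>
     (1 - w^2) * deriv (gegenbauer_S \<alpha> l) w - (1/2 + \<alpha> - l) * w * gegenbauer_S \<alpha> l w
        = - (1/2 + \<alpha> - l) * gegenbauer_S \<alpha> (l - 1) w \<and>
     w * deriv (gegenbauer_S \<alpha> l) w + (1/2 + \<alpha> - l) * gegenbauer_S \<alpha> l w
        = 1/2 * (1/2 + \<alpha> - l) * (3/2 + \<alpha> - l) * gegenbauer_S (\<alpha> + 1) (l - 1) w \<and>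
     w * (1 - w^2) * deriv (gegenbauer_S \<alpha> l) w
        + ((1/2 - \<alpha> + l) * (1 - w^2) - 2 * \<alpha> * w^2) * gegenbauer_S \<alpha> l w
        = - 2 * gegenbauer_S (\<alpha> - 1) (l + 1) w \<and>
     w * deriv (gegenbauer_S \<alpha> l) w + (1/2 + \<alpha> + l) * gegenbauer_S \<alpha> l w
        = 1/2 * (1/2 + \<alpha> + l) * (3/2 + \<alpha> + l) * gegenbauer_S (\<alpha> + 1) (l + 1) w \<and>
     w * (1 - w^2) * deriv (gegenbauer_S \<alpha> l) w
        + ((1/2 - \<alpha> - l) * (1 - w^2) - 2 * \<alpha> * w^2) * gegenbauer_S \<alpha> l w
        = - 2 * gegenbauer_S (\<alpha> - 1) (l - 1) w"
proof -
  define z where "z = (1 - w) / 2"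
  have w: "w = 1 - 2 * z" by (simp add: z_def field_simps)
  have z: "z \<in> hypergeo_domain"
  proof -
    have "z \<notin> complex_of_real ` {1..}"
    proof
      assume "z \<in> complex_of_real ` {1..}"
      then obtain x where "x \<ge> 1" "z = of_real x" by auto
      then have "w = of_real (1 - 2 * x)" "1 - 2 * x \<le> -1" by (auto simp: w)
      with assms show False by blast
    qed
    then show ?thesis by (simp add: hypergeo_domain_def)
  qed
  define a b c where "a = 1/2 + \<alpha> - l" and "b = 1/2 + \<alpha> + l" and "c = \<alpha> + 1"
  \<comment> \<open>Both orders are needed: exchanging \<open>a\<close> and \<open>b\<close> is the
    reflection of \<open>l\<close> to \<open>-l\<close>.\<close>
  have c: "2 * c = a + b + 1" and c': "2 * c = b + a + 1" by (simp_all add: a_def b_def c_def)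
  define H D where "H = hypergeo a b c z" and "D = deriv (hypergeo a b c) z"
  have S: "gegenbauer_S \<alpha> l w = H"
    by (simp add: gegenbauer_S_def H_def a_def b_def c_def z_def)
  have dS: "deriv (gegenbauer_S \<alpha> l) w = - (1/2) * D"
    using z by (simp add: deriv_gegenbauer_S D_def a_def b_def c_def z_def)
  have shift: "gegenbauer_S (\<alpha> + 1) l w = hypergeo (a + 1) (b + 1) (c + 1) z"
    "gegenbauer_S (\<alpha> - 1) l w = hypergeo (a - 1) (b - 1) (c - 1) z"
    "gegenbauer_S \<alpha> (l + 1) w = hypergeo (a - 1) (b + 1) c z"
    "gegenbauer_S \<alpha> (l - 1) w = hypergeo (b - 1) (a + 1) c z"
    "gegenbauer_S (\<alpha> + 1) (l - 1) w = hypergeo (a + 2) b (c + 1) z"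
    "gegenbauer_S (\<alpha> - 1) (l + 1) w = hypergeo (a - 2) b (c - 1) z"
    "gegenbauer_S (\<alpha> + 1) (l + 1) w = hypergeo (b + 2) a (c + 1) z"
    "gegenbauer_S (\<alpha> - 1) (l - 1) w = hypergeo (b - 2) a (c - 1) z"
    unfolding gegenbauer_S_def z_def[symmetric]
       hypergeo_commute[of "b - 1" "a + 1"] hypergeo_commute[of "b + 2" a] hypergeo_commute[of "b - 2" a]
    by (simp_all add: a_def b_def c_def algebra_simps)
  have swap: "hypergeo b a c = hypergeo a b c" by (rule hypergeo_commute)
  have coeffs: "1/2 + \<alpha> - l = a" "1/2 + \<alpha> + l = b" "3/2 + \<alpha> - l = a + 1" "3/2 + \<alpha> + l = b + 1"
     "1/2 - \<alpha> + l = 1 - a" "1/2 - \<alpha> - l = 1 - b"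
    by (simp_all add: a_def b_def algebra_simps)
  \<comment> \<open>Entries 4, 7 and 8 arise from 3, 5 and 6 by this reflection.\<close>
  note rels = deriv_hypergeo[OF z, of a b c, folded D_def]
    hypergeo_lower_all[OF z, of a b c, folded H_def D_def]
    hypergeo_lower_first_raise_second[OF z c, folded H_def D_def]
    hypergeo_lower_first_raise_second[OF z c', unfolded swap, folded H_def D_def]
    hypergeo_raise_first_twice[OF z c, folded H_def D_def]
    hypergeo_lower_first_twice[OF z c, folded H_def D_def]
    hypergeo_raise_first_twice[OF z c', unfolded swap, folded H_def D_def]
    hypergeo_lower_first_twice[OF z c', unfolded swap, folded H_def D_def]
  \<comment> \<open>With \<open>w = 1 - 2 * z\<close> and \<open>1 - w^2 = 4 z (1 - z)\<close>, all
    claims become polynomial identities in \<open>a\<close>, \<open>b\<close>, \<open>c\<close>,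
    \<open>z\<close>, \<open>H\<close>, \<open>D\<close> and the shifted values.\<close>
  have al: "\<alpha> = c - 1" by (simp add: c_def)
  show ?thesis
    unfolding S dS shift coeffs unfolding al w
  proof (intro conjI, goal_cases)
    case 1 show ?case using rels(1) by algebra
  next
    case 2
    \<comment> \<open>Turns \<open>c - 1 - (a + b - 1) * z\<close> into
      \<open>(c - 1) (1 - 2 z)\<close>, that is \<open>\<alpha> * w\<close>.\<close>
    have ab: "a + b - 1 = 2 * (c - 1)" using c by (simp add: algebra_simps)
    show ?case
      unfolding rels(2)[symmetric] ab by (simp add: power2_eq_square algebra_simps)
  next
    case 3 show ?case using rels(3) by algebra
  next
    case 4 show ?case using rels(4) by algebra
  next
    case 5 show ?case using rels(5) by algebra
  next
    case 6 show ?case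
      unfolding rels(6)[symmetric] by (simp add: power2_eq_square algebra_simps)
  next
    case 7 show ?case using rels(7) by algebra
  next
    case 8 show ?case
      unfolding rels(8)[symmetric] by (simp add: power2_eq_square algebra_simps)
  qed
qed

end
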